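(* Let $m\ge 1$ and $k\ge 1$ be integers and let $L$ be a Lie algebra over a field with $L\cong H(m)\oplus A(k)$. Then $L$ is capable if and only if $m=1$.
   Context: All Lie algebras are finite dimensional over a fixed field. A Lie algebra $L$ is called capable if there exists a Lie algebra $E$ such that $L\cong E/Z(E)$, where $Z(E)$ is the center of $E$. $A(k)$ denotes the abelian Lie algebra of dimension $k$. The Heisenberg Lie algebra $H(m)$, of dimension $2m+1$, has basis $x_1,\dots,x_m,y_1,\dots,y_m,z$ with $[x_i,y_i]=z$ for $1\le i\le m$ and all other brackets of basis elements (apart from those forced by antisymmetry) equal to zero. $\oplus$ denotes the direct sum of Lie algebras. *)

theory Defs
  imports "Jordan_Normal_Form.Missing_VectorSpace" "HOL-Algebra.QuotRing"
begin

section \<open>Lie algebras\<close>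

record ('a, 'b) lie_algebra = "('a, 'b) module" +
  bracket :: "'b \<Rightarrow> 'b \<Rightarrow> 'b"  (\<open>\<lbrakk>_, _\<rbrakk>\<index>\<close>)

text \<open>As for \<^locale>\<open>module\<close>, the fields \<^const>\<open>mult\<close> and \<^const>\<open>one\<close> inherited from
  \<^typ>\<open>'b ring\<close> play no role.  Requiring \<open>\<lbrakk>x, x\<rbrakk> = \<zero>\<close> rather than antisymmetry gives the correct
  notion in characteristic 2 as well.\<close>

locale lie_algebra = vectorspace K L
  for K and L :: "('a, 'b, 'p) lie_algebra_scheme" (structure) +
  assumes bracket_closed [simp, intro]:
      "\<lbrakk>x \<in> carrier L; y \<in> carrier L\<rbrakk> \<Longrightarrow> \<lbrakk>x, y\<rbrakk> \<in> carrier L"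
    and bracket_add_left:
      "\<lbrakk>x \<in> carrier L; y \<in> carrier L; z \<in> carrier L\<rbrakk> \<Longrightarrow> \<lbrakk>x \<oplus> y, z\<rbrakk> = \<lbrakk>x, z\<rbrakk> \<oplus> \<lbrakk>y, z\<rbrakk>"
    and bracket_add_right:
      "\<lbrakk>x \<in> carrier L; y \<in> carrier L; z \<in> carrier L\<rbrakk> \<Longrightarrow> \<lbrakk>x, y \<oplus> z\<rbrakk> = \<lbrakk>x, y\<rbrakk> \<oplus> \<lbrakk>x, z\<rbrakk>"
    and bracket_smult_left:
      "\<lbrakk>a \<in> carrier K; x \<in> carrier L; y \<in> carrier L\<rbrakk> \<Longrightarrow> \<lbrakk>a \<odot> x, y\<rbrakk> = a \<odot> \<lbrakk>x, y\<rbrakk>"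
    and bracket_smult_right:
      "\<lbrakk>a \<in> carrier K; x \<in> carrier L; y \<in> carrier L\<rbrakk> \<Longrightarrow> \<lbrakk>x, a \<odot> y\<rbrakk> = a \<odot> \<lbrakk>x, y\<rbrakk>"
    and bracket_self [simp]: "x \<in> carrier L \<Longrightarrow> \<lbrakk>x, x\<rbrakk> = \<zero>"
    and jacobi:
      "\<lbrakk>x \<in> carrier L; y \<in> carrier L; z \<in> carrier L\<rbrakk> \<Longrightarrow>
        \<lbrakk>x, \<lbrakk>y, z\<rbrakk>\<rbrakk> \<oplus> \<lbrakk>y, \<lbrakk>z, x\<rbrakk>\<rbrakk> \<oplus> \<lbrakk>z, \<lbrakk>x, y\<rbrakk>\<rbrakk> = \<zero>"

locale fin_dim_lie_algebra = lie_algebra K L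
  for K and L :: "('a, 'b, 'p) lie_algebra_scheme" (structure) +
  assumes fin_dim: fin_dim

definition lie_isomorphic ::
  "('a, 'r) ring_scheme \<Rightarrow> ('a, 'b, 'p) lie_algebra_scheme \<Rightarrow> ('a, 'c, 'q) lie_algebra_scheme \<Rightarrow> bool"
  where "lie_isomorphic K L M \<longleftrightarrow>
    (\<exists>f \<in> module_hom K L M. bij_betw f (carrier L) (carrier M) \<and>
      (\<forall>x \<in> carrier L. \<forall>y \<in> carrier L. f \<lbrakk>x, y\<rbrakk>\<^bsub>L\<^esub> = \<lbrakk>f x, f y\<rbrakk>\<^bsub>M\<^esub>))"

definition lie_center :: "('a, 'b, 'p) lie_algebra_scheme \<Rightarrow> 'b set"
  where "lie_center L = {z \<in> carrier L. \<forall>x \<in> carrier L. \<lbrakk>z, x\<rbrakk>\<^bsub>L\<^esub> = \<zero>\<^bsub>L\<^esub>}"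

text \<open>Scalars and brackets act on cosets through representatives, in the style of
  \<^const>\<open>rcoset_mult\<close>; if \<open>I\<close> is an ideal, then all members of the unions below coincide.\<close>

definition lie_quotient ::
  "('a, 'b, 'p) lie_algebra_scheme \<Rightarrow> 'b set \<Rightarrow> ('a, 'b set) lie_algebra"
  where "lie_quotient L I =
    \<lparr>carrier = a_rcosets\<^bsub>L\<^esub> I, mult = undefined, one = undefined,
     zero = I, add = set_add L,
     smult = (\<lambda>a A. \<Union>x \<in> A. I +>\<^bsub>L\<^esub> (a \<odot>\<^bsub>L\<^esub> x)),
     bracket = (\<lambda>A B. \<Union>x \<in> A. \<Union>y \<in> B. I +>\<^bsub>L\<^esub> \<lbrakk>x, y\<rbrakk>\<^bsub>L\<^esub>)\<rparr>"

text \<open>HOL cannot quantify over the type carrying \<open>E\<close>.  Every finite-dimensional Lie algebra over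
  \<open>K\<close> has an isomorphic copy carried by a subset of \<^typ>\<open>nat \<Rightarrow> 'a\<close>, so nothing is lost;
  see \<open>capableI\<close> below.\<close>

definition capable :: "('a, 'r) ring_scheme \<Rightarrow> ('a, 'b, 'p) lie_algebra_scheme \<Rightarrow> bool"
  where "capable K L \<longleftrightarrow>
    (\<exists>E :: ('a, nat \<Rightarrow> 'a) lie_algebra.
      fin_dim_lie_algebra K E \<and> lie_isomorphic K L (lie_quotient E (lie_center E)))"


section \<open>Direct sums, abelian and Heisenberg Lie algebras\<close>

abbreviation add_bracket :: "('a, 'b) module \<Rightarrow> ('b \<Rightarrow> 'b \<Rightarrow> 'b) \<Rightarrow> ('a, 'b) lie_algebra"
  where "add_bracket M b \<equiv> module.extend M (lie_algebra.fields b)"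

definition lie_direct_sum ::
  "('a, 'b, 'p) lie_algebra_scheme \<Rightarrow> ('a, 'c, 'q) lie_algebra_scheme \<Rightarrow> ('a, 'b \<times> 'c) lie_algebra"
  where "lie_direct_sum L M = add_bracket (direct_sum L M)
    (\<lambda>u v. (\<lbrakk>fst u, fst v\<rbrakk>\<^bsub>L\<^esub>, \<lbrakk>snd u, snd v\<rbrakk>\<^bsub>M\<^esub>))"

text \<open>In both families below a vector is represented by its coordinate function on the index set
  of the distinguished basis, undefined elsewhere.\<close>

definition abelian_lie_algebra :: "('a, 'r) ring_scheme \<Rightarrow> nat \<Rightarrow> ('a, nat \<Rightarrow> 'a) lie_algebra"
  where "abelian_lie_algebra K k = add_bracket (ring.func_space K {1..k})
    (\<lambda>u v. \<zero>\<^bsub>ring.func_space K {1..k}\<^esub>)"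

datatype heisenberg_index = X nat | Y nat | Z
hide_const (open) X Y Z

definition heisenberg_indices :: "nat \<Rightarrow> heisenberg_index set"
  where "heisenberg_indices m =
    heisenberg_index.X ` {1..m} \<union> heisenberg_index.Y ` {1..m} \<union> {heisenberg_index.Z}"

text \<open>The bilinear extension of \<open>\<lbrakk>x\<^sub>i, y\<^sub>i\<rbrakk> = z = - \<lbrakk>y\<^sub>i, x\<^sub>i\<rbrakk>\<close>.\<close>

definition heisenberg ::
  "('a, 'r) ring_scheme \<Rightarrow> nat \<Rightarrow> ('a, heisenberg_index \<Rightarrow> 'a) lie_algebra"
  where "heisenberg K m = add_bracket (ring.func_space K (heisenberg_indices m))
    (\<lambda>u v. \<lambda>j \<in> heisenberg_indices m.
      if j = heisenberg_index.Z then
        \<Oplus>\<^bsub>K\<^esub>i \<in> {1..m}.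
          u (heisenberg_index.X i) \<otimes>\<^bsub>K\<^esub> v (heisenberg_index.Y i) \<ominus>\<^bsub>K\<^esub>
          u (heisenberg_index.Y i) \<otimes>\<^bsub>K\<^esub> v (heisenberg_index.X i)
      else \<zero>\<^bsub>K\<^esub>)"


section \<open>Independence of the carrier type\<close>

lemma lie_isomorphic_trans:
  assumes "lie_isomorphic K L M" and "lie_isomorphic K M N"
  shows "lie_isomorphic K L N"
proof -
  obtain f where f: "f \<in> module_hom K L M" "bij_betw f (carrier L) (carrier M)"
      "\<And>x y. x \<in> carrier L \<Longrightarrow> y \<in> carrier L \<Longrightarrow> f \<lbrakk>x, y\<rbrakk>\<^bsub>L\<^esub> = \<lbrakk>f x, f y\<rbrakk>\<^bsub>M\<^esub>"
    using assms(1) unfolding lie_isomorphic_def by blast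
  obtain g where g: "g \<in> module_hom K M N" "bij_betw g (carrier M) (carrier N)"
      "\<And>x y. x \<in> carrier M \<Longrightarrow> y \<in> carrier M \<Longrightarrow> g \<lbrakk>x, y\<rbrakk>\<^bsub>M\<^esub> = \<lbrakk>g x, g y\<rbrakk>\<^bsub>N\<^esub>"
    using assms(2) unfolding lie_isomorphic_def by blast
  have "g \<circ> f \<in> module_hom K L N"
    using f(1) g(1) by (auto simp: module_hom_def Pi_iff)
  moreover have "bij_betw (g \<circ> f) (carrier L) (carrier N)"
    using f(2) g(2) by (rule bij_betw_trans)
  moreover have "(g \<circ> f) \<lbrakk>x, y\<rbrakk>\<^bsub>L\<^esub> = \<lbrakk>(g \<circ> f) x, (g \<circ> f) y\<rbrakk>\<^bsub>N\<^esub>"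
    if "x \<in> carrier L" "y \<in> carrier L" for x y
    using that f g by (auto simp: module_hom_def Pi_iff)
  ultimately show ?thesis unfolding lie_isomorphic_def by blast
qed

lemma quotient_center_isomorphic:
  assumes E: "lie_algebra K E" and F: "lie_algebra K F" and "lie_isomorphic K E F"
  shows "lie_isomorphic K (lie_quotient E (lie_center E)) (lie_quotient F (lie_center F))"
proof -
  interpret E: lie_algebra K E by (fact E)
  interpret F: lie_algebra K F by (fact F)
  obtain f where hom: "f \<in> module_hom K E F" and bij: "bij_betw f (carrier E) (carrier F)"
      and br: "\<And>x y. x \<in> carrier E \<Longrightarrow> y \<in> carrier E \<Longrightarrow> f \<lbrakk>x, y\<rbrakk>\<^bsub>E\<^esub> = \<lbrakk>f x, f y\<rbrakk>\<^bsub>F\<^esub>"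
    using assms(3) unfolding lie_isomorphic_def by blast
  have cl: "\<And>x. x \<in> carrier E \<Longrightarrow> f x \<in> carrier F"
    and ad: "\<And>x y. x \<in> carrier E \<Longrightarrow> y \<in> carrier E \<Longrightarrow> f (x \<oplus>\<^bsub>E\<^esub> y) = f x \<oplus>\<^bsub>F\<^esub> f y"
    and sm: "\<And>a x. a \<in> carrier K \<Longrightarrow> x \<in> carrier E \<Longrightarrow> f (a \<odot>\<^bsub>E\<^esub> x) = a \<odot>\<^bsub>F\<^esub> f x"
    using hom by (auto simp: module_hom_def)
  have im: "f ` carrier E = carrier F" and inj: "inj_on f (carrier E)"
    using bij by (auto simp: bij_betw_def)
  have z: "f \<zero>\<^bsub>E\<^esub> = \<zero>\<^bsub>F\<^esub>"
    using sm[of "\<zero>\<^bsub>K\<^esub>" "\<zero>\<^bsub>E\<^esub>"] cl[of "\<zero>\<^bsub>E\<^esub>"] by simp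
  let ?I = "lie_center E" and ?J = "lie_center F"
  have I: "?I \<subseteq> carrier E" and J: "?J \<subseteq> carrier F" by (auto simp: lie_center_def)
  have IJ: "f ` ?I = ?J"
  proof (intro equalityI subsetI)
    fix y assume "y \<in> f ` ?I"
    then obtain x where x: "x \<in> ?I" "y = f x" by blast
    then have xc: "x \<in> carrier E" using I by blast
    have "\<lbrakk>f x, w\<rbrakk>\<^bsub>F\<^esub> = \<zero>\<^bsub>F\<^esub>" if w: "w \<in> carrier F" for w
    proof -
      obtain v where v: "v \<in> carrier E" "w = f v" using w im by blast
      then show ?thesis using x(1) br[OF xc v(1)] z by (simp add: lie_center_def)
    qed
    then show "y \<in> ?J" using x xc cl by (simp add: lie_center_def)
  next
    fix y assume y: "y \<in> ?J"
    then obtain x where x: "x \<in> carrier E" "y = f x" using J im by blast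
    have "\<lbrakk>x, v\<rbrakk>\<^bsub>E\<^esub> = \<zero>\<^bsub>E\<^esub>" if v: "v \<in> carrier E" for v
    proof -
      have "f \<lbrakk>x, v\<rbrakk>\<^bsub>E\<^esub> = f \<zero>\<^bsub>E\<^esub>"
        using br[OF x(1) v] y x v cl z by (simp add: lie_center_def)
      then show ?thesis using inj x(1) v by (meson E.bracket_closed E.M.zero_closed inj_onD)
    qed
    then show "y \<in> f ` ?I" using x by (auto simp: lie_center_def)
  qed
  have co: "f ` (?I +>\<^bsub>E\<^esub> x) = ?J +>\<^bsub>F\<^esub> f x" if "x \<in> carrier E" for x
    unfolding a_r_coset_def r_coset_def IJ[symmetric]
    using that I by (auto simp: ad subset_iff image_iff intro!: bexI)
  have coc: "?I +>\<^bsub>E\<^esub> x \<subseteq> carrier E" if "x \<in> carrier E" for x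
    unfolding a_r_coset_def r_coset_def using that I by auto
  let ?P = "lie_quotient E ?I" and ?Q = "lie_quotient F ?J"
  have carP: "carrier ?P = (\<lambda>x. ?I +>\<^bsub>E\<^esub> x) ` carrier E"
    and carQ: "carrier ?Q = (\<lambda>x. ?J +>\<^bsub>F\<^esub> x) ` carrier F"
    by (auto simp: lie_quotient_def A_RCOSETS_def RCOSETS_def a_r_coset_def)
  have sub: "A \<subseteq> carrier E" if "A \<in> carrier ?P" for A
    using that coc by (auto simp: carP)
  have imPQ: "(`) f ` carrier ?P = carrier ?Q"
    unfolding carP carQ im[symmetric] image_image by (rule image_cong[OF refl co])
  have injPQ: "inj_on ((`) f) (carrier ?P)"
    using inj sub by (auto intro!: inj_onI simp: inj_on_image_eq_iff)
  have "f ` (A \<oplus>\<^bsub>?P\<^esub> B) = f ` A \<oplus>\<^bsub>?Q\<^esub> f ` B"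
    if "A \<in> carrier ?P" "B \<in> carrier ?P" for A B
  proof -
    have "f ` (\<Union>a\<in>A. \<Union>b\<in>B. {a \<oplus>\<^bsub>E\<^esub> b}) = (\<Union>a\<in>A. \<Union>b\<in>B. {f (a \<oplus>\<^bsub>E\<^esub> b)})"
      by blast
    also have "\<dots> = (\<Union>a\<in>A. \<Union>b\<in>B. {f a \<oplus>\<^bsub>F\<^esub> f b})"
      using sub[OF that(1)] sub[OF that(2)] by (intro SUP_cong refl) (simp add: ad subset_iff)
    finally show ?thesis by (simp add: lie_quotient_def set_add_def set_mult_def)
  qed
  moreover have "f ` (a \<odot>\<^bsub>?P\<^esub> A) = a \<odot>\<^bsub>?Q\<^esub> f ` A"
    if "a \<in> carrier K" "A \<in> carrier ?P" for a A
  proof -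
    have "f ` (\<Union>x\<in>A. ?I +>\<^bsub>E\<^esub> (a \<odot>\<^bsub>E\<^esub> x)) = (\<Union>x\<in>A. f ` (?I +>\<^bsub>E\<^esub> (a \<odot>\<^bsub>E\<^esub> x)))"
      by blast
    also have "\<dots> = (\<Union>x\<in>A. ?J +>\<^bsub>F\<^esub> (a \<odot>\<^bsub>F\<^esub> f x))"
      using sub[OF that(2)] that(1) by (intro SUP_cong refl) (simp add: co sm subset_iff)
    finally show ?thesis by (simp add: lie_quotient_def)
  qed
  moreover have "f ` \<lbrakk>A, B\<rbrakk>\<^bsub>?P\<^esub> = \<lbrakk>f ` A, f ` B\<rbrakk>\<^bsub>?Q\<^esub>"
    if "A \<in> carrier ?P" "B \<in> carrier ?P" for A B
  proof -
    have "f ` (\<Union>x\<in>A. \<Union>y\<in>B. ?I +>\<^bsub>E\<^esub> \<lbrakk>x, y\<rbrakk>\<^bsub>E\<^esub>)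
        = (\<Union>x\<in>A. \<Union>y\<in>B. f ` (?I +>\<^bsub>E\<^esub> \<lbrakk>x, y\<rbrakk>\<^bsub>E\<^esub>))"
      by blast
    also have "\<dots> = (\<Union>x\<in>A. \<Union>y\<in>B. ?J +>\<^bsub>F\<^esub> \<lbrakk>f x, f y\<rbrakk>\<^bsub>F\<^esub>)"
      using sub[OF that(1)] sub[OF that(2)]
      by (intro SUP_cong refl) (simp add: co br subset_iff)
    finally show ?thesis by (simp add: lie_quotient_def)
  qed
  ultimately show ?thesis
    unfolding lie_isomorphic_def using imPQ injPQ
    by (intro bexI[of _ "(`) f"]) (auto simp: module_hom_def bij_betw_def)
qed

definition transport :: "('b \<Rightarrow> 'c) \<Rightarrow> ('a, 'b, 'p) lie_algebra_scheme \<Rightarrow> ('a, 'c) lie_algebra"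
  where "transport f E = (let g = inv_into (carrier E) f in
    \<lparr>carrier = f ` carrier E, mult = undefined, one = undefined, zero = f \<zero>\<^bsub>E\<^esub>,
     add = (\<lambda>u v. f (g u \<oplus>\<^bsub>E\<^esub> g v)), smult = (\<lambda>a u. f (a \<odot>\<^bsub>E\<^esub> g u)),
     bracket = (\<lambda>u v. f \<lbrakk>g u, g v\<rbrakk>\<^bsub>E\<^esub>)\<rparr>)"

lemma transport_lie_algebra:
  assumes "fin_dim_lie_algebra K E" and inj: "inj_on f (carrier E)"
  shows "fin_dim_lie_algebra K (transport f E)" and "lie_isomorphic K E (transport f E)"
proof -
  interpret E: fin_dim_lie_algebra K E by (fact assms(1))
  let ?F = "transport f E"
  have [simp]: "carrier ?F = f ` carrier E" "\<zero>\<^bsub>?F\<^esub> = f \<zero>\<^bsub>E\<^esub>"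
    by (simp_all add: transport_def Let_def)
  have ops [simp]:
    "\<And>x y. x \<in> carrier E \<Longrightarrow> y \<in> carrier E \<Longrightarrow> f x \<oplus>\<^bsub>?F\<^esub> f y = f (x \<oplus>\<^bsub>E\<^esub> y)"
    "\<And>a x. x \<in> carrier E \<Longrightarrow> a \<odot>\<^bsub>?F\<^esub> f x = f (a \<odot>\<^bsub>E\<^esub> x)"
    "\<And>x y. x \<in> carrier E \<Longrightarrow> y \<in> carrier E \<Longrightarrow> \<lbrakk>f x, f y\<rbrakk>\<^bsub>?F\<^esub> = f \<lbrakk>x, y\<rbrakk>\<^bsub>E\<^esub>"
    using inj by (simp_all add: transport_def Let_def)
  have "abelian_group ?F"
  proof (rule abelian_groupI)
    fix u assume "u \<in> carrier ?F"
    then obtain x where "x \<in> carrier E" "u = f x" by auto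
    then show "\<exists>v \<in> carrier ?F. v \<oplus>\<^bsub>?F\<^esub> u = \<zero>\<^bsub>?F\<^esub>"
      by (intro bexI[of _ "f (\<ominus>\<^bsub>E\<^esub> x)"]) (auto simp: E.M.l_neg)
  qed (auto simp: E.M.a_ac)
  then have F: "module K ?F"
    by (intro moduleI E.is_cring)
      (auto simp: E.smult_l_distr E.smult_r_distr E.smult_assoc1)
  interpret F: vectorspace K ?F
    using F E.field_axioms by (simp add: vectorspace_def)
  have hom: "f \<in> module_hom K E ?F" by (auto simp: module_hom_def)
  have "linear_map K E ?F f"
    by unfold_locales (fact hom)
  then have fd: "F.fin_dim"
    using linear_map.rank_nullity_main(2) E.fin_dim by fastforce
  have "lie_algebra K ?F"
  proof (unfold_locales, goal_cases)
    case 7 then show ?case by (auto simp: E.jacobi)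
  qed (auto simp: E.bracket_add_left E.bracket_add_right E.bracket_smult_left E.bracket_smult_right)
  then show "fin_dim_lie_algebra K ?F"
    using fd by (simp add: fin_dim_lie_algebra_def fin_dim_lie_algebra_axioms_def)
  show "lie_isomorphic K E ?F"
    unfolding lie_isomorphic_def using hom inj by (auto simp: bij_betw_def)
qed

lemma (in fin_dim_lie_algebra) ex_inj_coordinates:
  obtains f :: "'b \<Rightarrow> nat \<Rightarrow> 'a" where "inj_on f (carrier L)"
proof -
  obtain A where A: "finite A" "A \<subseteq> carrier L" "gen_set A"
    using fin_dim unfolding fin_dim_def by blast
  obtain e :: "nat \<Rightarrow> 'b" where e: "bij_betw e {..<card A} A"
    using ex_bij_betw_nat_finite[OF A(1)] by (auto simp: lessThan_atLeast0)
  have "\<exists>c. c \<in> A \<rightarrow> carrier K \<and> lincomb c A = v" if "v \<in> carrier L" for v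
  proof -
    have "v \<in> {lincomb a A |a. a \<in> A \<rightarrow> carrier K}"
      using that A(3) finite_span[OF A(1,2)] by simp
    then show ?thesis by blast
  qed
  then obtain c where c: "\<And>v. v \<in> carrier L \<Longrightarrow> c v \<in> A \<rightarrow> carrier K \<and> lincomb (c v) A = v"
    by metis
  have "inj_on (\<lambda>v. c v \<circ> e) (carrier L)"
  proof (rule inj_onI)
    fix v w assume vw: "v \<in> carrier L" "w \<in> carrier L" "c v \<circ> e = c w \<circ> e"
    have eq: "c v a = c w a" if "a \<in> A" for a
    proof -
      obtain i where "a = e i" using e \<open>a \<in> A\<close> by (auto simp: bij_betw_def)
      then show ?thesis using fun_cong[OF vw(3), of i] by simp
    qed
    have "lincomb (c v) A = lincomb (c w) A"
      using A c vw eq by (intro lincomb_cong) auto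
    then show "v = w" using c vw by metis
  qed
  then show ?thesis by (rule that)
qed

proposition capableI:
  fixes K :: "('a, 'r) ring_scheme" and E :: "('a, 'e, 'p) lie_algebra_scheme"
  assumes "fin_dim_lie_algebra K E" and "lie_isomorphic K L (lie_quotient E (lie_center E))"
  shows "capable K L"
proof -
  obtain f :: "'e \<Rightarrow> nat \<Rightarrow> 'a" where f: "inj_on f (carrier E)"
    using fin_dim_lie_algebra.ex_inj_coordinates[OF assms(1)] by blast
  note F = transport_lie_algebra[OF assms(1) f]
  have "lie_isomorphic K (lie_quotient E (lie_center E))
      (lie_quotient (transport f E) (lie_center (transport f E)))"
    using assms(1) F by (intro quotient_center_isomorphic) (auto simp: fin_dim_lie_algebra_def)
  then show ?thesis
    unfolding capable_def using F(1) assms(2) lie_isomorphic_trans by blast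
qed



section \<open>The constructions above yield Lie algebras\<close>

lemma module_add_bracket:
  assumes "module K M"
  shows "module K (add_bracket M b)"
proof -
  interpret M: module K M by (fact assms)
  show ?thesis
  proof (intro moduleI M.is_cring abelian_groupI)
    fix x assume "x \<in> carrier (add_bracket M b)"
    then show "\<exists>y \<in> carrier (add_bracket M b). y \<oplus>\<^bsub>add_bracket M b\<^esub> x = \<zero>\<^bsub>add_bracket M b\<^esub>"
      by (intro bexI[of _ "\<ominus>\<^bsub>M\<^esub> x"]) (auto simp: module.defs M.M.l_neg)
  qed (auto simp: module.defs M.M.a_ac M.smult_l_distr M.smult_r_distr M.smult_assoc1)
qed

lemma lie_direct_sum_lie_algebra:
  assumes "lie_algebra K L" and "lie_algebra K M"
  shows "lie_algebra K (lie_direct_sum L M)"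
proof -
  interpret L: lie_algebra K L by (fact assms(1))
  interpret M: lie_algebra K M by (fact assms(2))
  have "module K (lie_direct_sum L M)"
    unfolding lie_direct_sum_def
    by (intro module_add_bracket direct_sum_is_module L.module_axioms M.module_axioms)
  then interpret vectorspace K "lie_direct_sum L M"
    using L.field_axioms by (simp add: vectorspace_def)
  show ?thesis
    by unfold_locales
      (auto simp: lie_direct_sum_def direct_sum_def module.defs lie_algebra.defs
        L.bracket_add_left L.bracket_add_right L.bracket_smult_left L.bracket_smult_right L.jacobi
        M.bracket_add_left M.bracket_add_right M.bracket_smult_left M.bracket_smult_right M.jacobi)
qed

lemma abelian_lie_algebra_lie_algebra:
  assumes "field K"
  shows "lie_algebra K (abelian_lie_algebra K k)"
proof -
  interpret K: field K by (fact assms)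
  have "module K (abelian_lie_algebra K k)"
    unfolding abelian_lie_algebra_def by (intro module_add_bracket K.func_space_is_module)
  then interpret vectorspace K "abelian_lie_algebra K k"
    using assms by (simp add: vectorspace_def)
  have "\<zero>\<^bsub>abelian_lie_algebra K k\<^esub> \<in> carrier (abelian_lie_algebra K k)" by simp
  moreover have "\<lbrakk>u, v\<rbrakk>\<^bsub>abelian_lie_algebra K k\<^esub> = \<zero>\<^bsub>abelian_lie_algebra K k\<^esub>" for u v
    by (simp add: abelian_lie_algebra_def module.defs lie_algebra.defs)
  ultimately show ?thesis
    by unfold_locales simp_all
qed

lemma heisenberg_lie_algebra:
  assumes "field K"
  shows "lie_algebra K (heisenberg K m)"
proof -
  interpret K: field K by (fact assms)
  let ?H = "heisenberg K m" and ?X = heisenberg_index.X and ?Y = heisenberg_index.Y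
    and ?I = "heisenberg_indices m"
  have "module K ?H"
    unfolding heisenberg_def by (intro module_add_bracket K.func_space_is_module)
  then interpret vectorspace K ?H
    using assms by (simp add: vectorspace_def)
  have simps: "carrier ?H = ?I \<rightarrow>\<^sub>E carrier K" "\<zero>\<^bsub>?H\<^esub> = (\<lambda>i\<in>?I. \<zero>\<^bsub>K\<^esub>)"
      "\<And>u v. u \<oplus>\<^bsub>?H\<^esub> v = (\<lambda>i\<in>?I. u i \<oplus>\<^bsub>K\<^esub> v i)"
      "\<And>a u. a \<odot>\<^bsub>?H\<^esub> u = (\<lambda>i\<in>?I. a \<otimes>\<^bsub>K\<^esub> u i)"
    by (simp_all add: heisenberg_def K.func_space_def module.defs)
  have I: "?X i \<in> ?I" "?Y i \<in> ?I" if "i \<in> {1..m}" for i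
    using that by (auto simp: heisenberg_indices_def)
  define \<omega> where "\<omega> u v = (\<Oplus>\<^bsub>K\<^esub>i \<in> {1..m}. u (?X i) \<otimes>\<^bsub>K\<^esub> v (?Y i) \<ominus>\<^bsub>K\<^esub> u (?Y i) \<otimes>\<^bsub>K\<^esub> v (?X i))"
    for u v :: "heisenberg_index \<Rightarrow> 'a"
  define \<zeta> where "\<zeta> c = (\<lambda>j\<in>?I. if j = heisenberg_index.Z then c else \<zero>\<^bsub>K\<^esub>)" for c
  have br: "\<lbrakk>u, v\<rbrakk>\<^bsub>?H\<^esub> = \<zeta> (\<omega> u v)" for u v
    unfolding \<omega>_def \<zeta>_def by (simp add: heisenberg_def module.defs lie_algebra.defs)
  have \<zeta>: "\<And>c. c \<in> carrier K \<Longrightarrow> \<zeta> c \<in> carrier ?H"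
      "\<And>c d. c \<in> carrier K \<Longrightarrow> d \<in> carrier K \<Longrightarrow> \<zeta> (c \<oplus>\<^bsub>K\<^esub> d) = \<zeta> c \<oplus>\<^bsub>?H\<^esub> \<zeta> d"
      "\<And>a c. a \<in> carrier K \<Longrightarrow> c \<in> carrier K \<Longrightarrow> \<zeta> (a \<otimes>\<^bsub>K\<^esub> c) = a \<odot>\<^bsub>?H\<^esub> \<zeta> c"
      "\<zeta> \<zero>\<^bsub>K\<^esub> = \<zero>\<^bsub>?H\<^esub>"
    unfolding simps by (auto simp: \<zeta>_def restrict_def fun_eq_iff)
  have cl: "u (?X i) \<in> carrier K" "u (?Y i) \<in> carrier K"
    if "u \<in> carrier ?H" "i \<in> {1..m}" for u i
    using that I by (auto simp: simps)
  have [simp]: "\<omega> u v \<in> carrier K" if "u \<in> carrier ?H" "v \<in> carrier ?H" for u v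
    unfolding \<omega>_def using that by (intro K.finsum_closed) (auto simp: cl)
  have add_l: "\<omega> (u \<oplus>\<^bsub>?H\<^esub> v) w = \<omega> u w \<oplus>\<^bsub>K\<^esub> \<omega> v w"
    if "u \<in> carrier ?H" "v \<in> carrier ?H" "w \<in> carrier ?H" for u v w
  proof -
    have "\<omega> u w \<oplus>\<^bsub>K\<^esub> \<omega> v w = (\<Oplus>\<^bsub>K\<^esub>i \<in> {1..m}.
        (u (?X i) \<otimes>\<^bsub>K\<^esub> w (?Y i) \<ominus>\<^bsub>K\<^esub> u (?Y i) \<otimes>\<^bsub>K\<^esub> w (?X i)) \<oplus>\<^bsub>K\<^esub>
        (v (?X i) \<otimes>\<^bsub>K\<^esub> w (?Y i) \<ominus>\<^bsub>K\<^esub> v (?Y i) \<otimes>\<^bsub>K\<^esub> w (?X i)))"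
      unfolding \<omega>_def using that by (intro K.finsum_addf[symmetric]) (auto simp: cl)
    also have "\<dots> = \<omega> (u \<oplus>\<^bsub>?H\<^esub> v) w"
      unfolding \<omega>_def
    proof (intro K.finsum_cong' refl)
      fix i assume i: "i \<in> {1..m}"
      note c = cl[OF that(1) i] cl[OF that(2) i] cl[OF that(3) i]
      have "(a \<otimes>\<^bsub>K\<^esub> y \<ominus>\<^bsub>K\<^esub> b \<otimes>\<^bsub>K\<^esub> x) \<oplus>\<^bsub>K\<^esub> (c \<otimes>\<^bsub>K\<^esub> y \<ominus>\<^bsub>K\<^esub> d \<otimes>\<^bsub>K\<^esub> x) =
          (a \<oplus>\<^bsub>K\<^esub> c) \<otimes>\<^bsub>K\<^esub> y \<ominus>\<^bsub>K\<^esub> (b \<oplus>\<^bsub>K\<^esub> d) \<otimes>\<^bsub>K\<^esub> x"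
        if "a \<in> carrier K" "b \<in> carrier K" "c \<in> carrier K" "d \<in> carrier K"
          "x \<in> carrier K" "y \<in> carrier K" for a b c d x y
        using that by algebra
      with c show "(u (?X i) \<otimes>\<^bsub>K\<^esub> w (?Y i) \<ominus>\<^bsub>K\<^esub> u (?Y i) \<otimes>\<^bsub>K\<^esub> w (?X i)) \<oplus>\<^bsub>K\<^esub>
          (v (?X i) \<otimes>\<^bsub>K\<^esub> w (?Y i) \<ominus>\<^bsub>K\<^esub> v (?Y i) \<otimes>\<^bsub>K\<^esub> w (?X i)) =
          (u \<oplus>\<^bsub>?H\<^esub> v) (?X i) \<otimes>\<^bsub>K\<^esub> w (?Y i) \<ominus>\<^bsub>K\<^esub> (u \<oplus>\<^bsub>?H\<^esub> v) (?Y i) \<otimes>\<^bsub>K\<^esub> w (?X i)"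
        using I[OF i] by (simp add: simps(3))
    qed (use that in \<open>auto simp: simps(3) I cl\<close>)
    finally show ?thesis by simp
  qed
  have smult_l: "\<omega> (a \<odot>\<^bsub>?H\<^esub> u) w = a \<otimes>\<^bsub>K\<^esub> \<omega> u w"
    if "a \<in> carrier K" "u \<in> carrier ?H" "w \<in> carrier ?H" for a u w
  proof -
    have "a \<otimes>\<^bsub>K\<^esub> \<omega> u w = (\<Oplus>\<^bsub>K\<^esub>i \<in> {1..m}.
        a \<otimes>\<^bsub>K\<^esub> (u (?X i) \<otimes>\<^bsub>K\<^esub> w (?Y i) \<ominus>\<^bsub>K\<^esub> u (?Y i) \<otimes>\<^bsub>K\<^esub> w (?X i)))"
      unfolding \<omega>_def using that by (intro K.finsum_rdistr) (auto simp: cl)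
    also have "\<dots> = \<omega> (a \<odot>\<^bsub>?H\<^esub> u) w"
      unfolding \<omega>_def
    proof (intro K.finsum_cong' refl)
      fix i assume i: "i \<in> {1..m}"
      note c = cl[OF that(2) i] cl[OF that(3) i]
      have "a \<otimes>\<^bsub>K\<^esub> (p \<otimes>\<^bsub>K\<^esub> y \<ominus>\<^bsub>K\<^esub> q \<otimes>\<^bsub>K\<^esub> x) = (a \<otimes>\<^bsub>K\<^esub> p) \<otimes>\<^bsub>K\<^esub> y \<ominus>\<^bsub>K\<^esub> (a \<otimes>\<^bsub>K\<^esub> q) \<otimes>\<^bsub>K\<^esub> x"
        if "p \<in> carrier K" "q \<in> carrier K" "x \<in> carrier K" "y \<in> carrier K" for p q x y
        using that \<open>a \<in> carrier K\<close> by algebra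
      with c show "a \<otimes>\<^bsub>K\<^esub> (u (?X i) \<otimes>\<^bsub>K\<^esub> w (?Y i) \<ominus>\<^bsub>K\<^esub> u (?Y i) \<otimes>\<^bsub>K\<^esub> w (?X i)) =
          (a \<odot>\<^bsub>?H\<^esub> u) (?X i) \<otimes>\<^bsub>K\<^esub> w (?Y i) \<ominus>\<^bsub>K\<^esub> (a \<odot>\<^bsub>?H\<^esub> u) (?Y i) \<otimes>\<^bsub>K\<^esub> w (?X i)"
        using I[OF i] by (simp add: simps(4))
    qed (use that in \<open>auto simp: simps(4) I cl\<close>)
    finally show ?thesis by simp
  qed
  have self: "\<omega> u u = \<zero>\<^bsub>K\<^esub>" if "u \<in> carrier ?H" for u
  proof -
    have "\<omega> u u = (\<Oplus>\<^bsub>K\<^esub>i \<in> {1..m}. \<zero>\<^bsub>K\<^esub>)"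
      unfolding \<omega>_def using that
      by (intro K.finsum_cong' refl) (auto simp: cl K.m_comm K.r_neg K.minus_eq)
    then show ?thesis by simp
  qed
  have skew: "\<omega> u v = \<ominus>\<^bsub>K\<^esub> \<omega> v u" if "u \<in> carrier ?H" "v \<in> carrier ?H" for u v
  proof -
    have "\<omega> u v \<oplus>\<^bsub>K\<^esub> \<omega> v u = (\<Oplus>\<^bsub>K\<^esub>i \<in> {1..m}.
        (u (?X i) \<otimes>\<^bsub>K\<^esub> v (?Y i) \<ominus>\<^bsub>K\<^esub> u (?Y i) \<otimes>\<^bsub>K\<^esub> v (?X i)) \<oplus>\<^bsub>K\<^esub>
        (v (?X i) \<otimes>\<^bsub>K\<^esub> u (?Y i) \<ominus>\<^bsub>K\<^esub> v (?Y i) \<otimes>\<^bsub>K\<^esub> u (?X i)))"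
      unfolding \<omega>_def using that by (intro K.finsum_addf[symmetric]) (auto simp: cl)
    also have "\<dots> = (\<Oplus>\<^bsub>K\<^esub>i \<in> {1..m}. \<zero>\<^bsub>K\<^esub>)"
    proof (intro K.finsum_cong' refl)
      fix i assume i: "i \<in> {1..m}"
      have "(p \<otimes>\<^bsub>K\<^esub> y \<ominus>\<^bsub>K\<^esub> q \<otimes>\<^bsub>K\<^esub> x) \<oplus>\<^bsub>K\<^esub> (x \<otimes>\<^bsub>K\<^esub> q \<ominus>\<^bsub>K\<^esub> y \<otimes>\<^bsub>K\<^esub> p) = \<zero>\<^bsub>K\<^esub>"
        if "p \<in> carrier K" "q \<in> carrier K" "x \<in> carrier K" "y \<in> carrier K" for p q x y
        using that by algebra
      then show "(u (?X i) \<otimes>\<^bsub>K\<^esub> v (?Y i) \<ominus>\<^bsub>K\<^esub> u (?Y i) \<otimes>\<^bsub>K\<^esub> v (?X i)) \<oplus>\<^bsub>K\<^esub>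
        (v (?X i) \<otimes>\<^bsub>K\<^esub> u (?Y i) \<ominus>\<^bsub>K\<^esub> v (?Y i) \<otimes>\<^bsub>K\<^esub> u (?X i)) = \<zero>\<^bsub>K\<^esub>"
        using cl[OF that(1) i] cl[OF that(2) i] by blast
    qed auto
    finally show ?thesis using that by (simp add: K.minus_equality)
  qed
  have add_r: "\<omega> w (u \<oplus>\<^bsub>?H\<^esub> v) = \<omega> w u \<oplus>\<^bsub>K\<^esub> \<omega> w v"
    if "u \<in> carrier ?H" "v \<in> carrier ?H" "w \<in> carrier ?H" for u v w
    using that skew[of w] by (simp add: add_l K.minus_add)
  have smult_r: "\<omega> w (a \<odot>\<^bsub>?H\<^esub> u) = a \<otimes>\<^bsub>K\<^esub> \<omega> w u"
    if "a \<in> carrier K" "u \<in> carrier ?H" "w \<in> carrier ?H" for a u w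
    using that skew[of w] by (simp add: smult_l K.r_minus)
  have nil: "\<omega> u \<lbrakk>v, w\<rbrakk>\<^bsub>?H\<^esub> = \<zero>\<^bsub>K\<^esub>" if "u \<in> carrier ?H" for u v w
  proof -
    have "\<omega> u \<lbrakk>v, w\<rbrakk>\<^bsub>?H\<^esub> = (\<Oplus>\<^bsub>K\<^esub>i \<in> {1..m}. \<zero>\<^bsub>K\<^esub>)"
      unfolding \<omega>_def[of u] using that I
      by (intro K.finsum_cong' refl) (auto simp: cl br \<zeta>_def K.minus_eq)
    then show ?thesis by simp
  qed
  have nil': "\<lbrakk>u, \<lbrakk>v, w\<rbrakk>\<^bsub>?H\<^esub>\<rbrakk>\<^bsub>?H\<^esub> = \<zero>\<^bsub>?H\<^esub>" if "u \<in> carrier ?H" for u v w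
    by (simp only: br[of u] nil[OF that] \<zeta>)
  show ?thesis
  proof (unfold_locales, goal_cases)
    case 7 then show ?case by (simp add: nil')
  qed (simp_all add: br \<zeta> add_l add_r smult_l smult_r self)
qed

end

theory Submission
  imports Defs
begin

text \<open>
  Suppose first that \<open>m \<ge> 2\<close> and \<open>L = E/Z(E)\<close>.  In \<open>L\<close> the central vector \<open>z\<close> is both
  \<open>[x\<^sub>1, y\<^sub>1]\<close> and \<open>[x\<^sub>2, y\<^sub>2]\<close>.  If \<open>u\<close> commutes with \<open>x\<^sub>i\<close> and \<open>y\<^sub>i\<close> in \<open>L\<close>, then the brackets of their
  lifts are central in \<open>E\<close>, so by the Jacobi identity a lift of \<open>u\<close> commutes with the bracket of the
  lifts of \<open>x\<^sub>i\<close> and \<open>y\<^sub>i\<close>, hence with every lift of \<open>z\<close>, since two lifts differ by a central element.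
  Every vector of \<open>L\<close> is a sum of one that commutes with \<open>x\<^sub>1, y\<^sub>1\<close> and one that commutes with
  \<open>x\<^sub>2, y\<^sub>2\<close>, so lifts of \<open>z\<close> are central in \<open>E\<close> and \<open>z = 0\<close>, a contradiction.  The abstract form of
  this argument is \<open>capable_bracket_eq_zero\<close>.

  For \<open>m = 1\<close> let \<open>\<phi>\<close> be the coordinate functional of \<open>x\<^sub>1\<close>.  Its kernel is an abelian ideal of
  codimension one, and any Lie algebra \<open>L\<close> of dimension at least two with such an ideal is capable:
  \<open>\<beta>(l, l') = \<phi>(l) l' - \<phi>(l') l\<close> is a 2-cocycle on \<open>L\<close> with values in the trivial module \<open>L\<close>, and it
  has no radical, so the corresponding central extension \<open>L \<times> L\<close> of \<open>L\<close> has centre exactly \<open>0 \<times> L\<close>.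
  This is proved in the locale \<open>codim_one_abelian_ideal\<close>.
\<close>

section \<open>Elementary facts on Lie algebras and their centres\<close>

context lie_algebra
begin

lemma bracket_zero_left [simp]: "x \<in> carrier L \<Longrightarrow> \<lbrakk>\<zero>, x\<rbrakk> = \<zero>"
  using bracket_smult_left[of "\<zero>\<^bsub>K\<^esub>" "\<zero>" x] by simp

lemma bracket_zero_right [simp]: "x \<in> carrier L \<Longrightarrow> \<lbrakk>x, \<zero>\<rbrakk> = \<zero>"
  using bracket_smult_right[of "\<zero>\<^bsub>K\<^esub>" x "\<zero>"] by simp

lemma minus_zero [simp]: "\<ominus> \<zero> = \<zero>"
  by (metis M.l_zero M.minus_equality M.zero_closed)

lemma bracket_skew:
  assumes "x \<in> carrier L" "y \<in> carrier L"
  shows "\<lbrakk>x, y\<rbrakk> = \<ominus> \<lbrakk>y, x\<rbrakk>"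
proof -
  have "\<zero> = \<lbrakk>x \<oplus> y, x \<oplus> y\<rbrakk>" using assms by simp
  also have "\<dots> = (\<lbrakk>x, x\<rbrakk> \<oplus> \<lbrakk>x, y\<rbrakk>) \<oplus> (\<lbrakk>y, x\<rbrakk> \<oplus> \<lbrakk>y, y\<rbrakk>)"
    using assms by (simp only: bracket_add_left bracket_add_right M.add.m_closed bracket_closed M.a_ac)
  finally show ?thesis using assms by (simp add: M.minus_equality)
qed

lemma center_closed: "lie_center L \<subseteq> carrier L"
  by (auto simp: lie_center_def)

lemma center_bracket_left: "h \<in> lie_center L \<Longrightarrow> x \<in> carrier L \<Longrightarrow> \<lbrakk>h, x\<rbrakk> = \<zero>"
  by (simp add: lie_center_def)

lemma center_bracket_right: "h \<in> lie_center L \<Longrightarrow> x \<in> carrier L \<Longrightarrow> \<lbrakk>x, h\<rbrakk> = \<zero>"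
  using bracket_skew[of x h] by (simp add: lie_center_def)

lemma center_smult: "a \<in> carrier K \<Longrightarrow> h \<in> lie_center L \<Longrightarrow> a \<odot> h \<in> lie_center L"
  by (auto simp: lie_center_def bracket_smult_left)

lemma center_abelian_subgroup: "abelian_subgroup (lie_center L) L"
proof (rule abelian_subgroupI3)
  show "additive_subgroup (lie_center L) L"
  proof (intro additive_subgroup.intro subgroup.intro)
    fix x assume x: "x \<in> lie_center L"
    then have "\<ominus> x = (\<ominus>\<^bsub>K\<^esub> \<one>\<^bsub>K\<^esub>) \<odot> x"
      by (simp add: lie_center_def smult_minus_1)
    then show "inv\<^bsub>add_monoid L\<^esub> x \<in> lie_center L"
      using center_smult[of "\<ominus>\<^bsub>K\<^esub> \<one>\<^bsub>K\<^esub>", OF _ x] by (simp add: a_inv_def)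
  qed (auto simp: lie_center_def bracket_add_left)
  show "abelian_group L" ..
qed

end

section \<open>Invariance of capability under isomorphism\<close>

lemma lie_isomorphic_sym:
  assumes L: "lie_algebra K L" and iso: "lie_isomorphic K L M"
  shows "lie_isomorphic K M L"
proof -
  interpret L: lie_algebra K L by (fact L)
  obtain f where hom: "f \<in> module_hom K L M" and bij: "bij_betw f (carrier L) (carrier M)"
      and br: "\<And>x y. x \<in> carrier L \<Longrightarrow> y \<in> carrier L \<Longrightarrow> f \<lbrakk>x, y\<rbrakk>\<^bsub>L\<^esub> = \<lbrakk>f x, f y\<rbrakk>\<^bsub>M\<^esub>"
    using iso unfolding lie_isomorphic_def by blast
  define g where "g = inv_into (carrier L) f"
  have bij_g: "bij_betw g (carrier M) (carrier L)"
    using bij unfolding g_def by (rule bij_betw_inv_into)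
  have cl: "g u \<in> carrier L" and fg: "f (g u) = u" if "u \<in> carrier M" for u
    using that bij bij_g by (auto simp: g_def bij_betw_def f_inv_into_f)
  have gI: "g u = x" if "x \<in> carrier L" "f x = u" for u x
    using that bij by (auto simp: g_def bij_betw_def)
  have "g (u \<oplus>\<^bsub>M\<^esub> v) = g u \<oplus>\<^bsub>L\<^esub> g v" if "u \<in> carrier M" "v \<in> carrier M" for u v
    using that by (intro gI) (auto simp: cl fg module_hom_add[OF hom])
  moreover have "g (a \<odot>\<^bsub>M\<^esub> u) = a \<odot>\<^bsub>L\<^esub> g u" if "a \<in> carrier K" "u \<in> carrier M" for a u
    using that by (intro gI) (auto simp: cl fg module_hom_smult[OF hom])
  moreover have "g \<lbrakk>u, v\<rbrakk>\<^bsub>M\<^esub> = \<lbrakk>g u, g v\<rbrakk>\<^bsub>L\<^esub>" if "u \<in> carrier M" "v \<in> carrier M" for u v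
    using that by (intro gI) (auto simp: cl fg br)
  ultimately show ?thesis
    unfolding lie_isomorphic_def using bij_g cl
    by (intro bexI[of _ g]) (auto simp: module_hom_def)
qed

lemma capable_cong:
  assumes "lie_algebra K L" and "lie_isomorphic K L M"
  shows "capable K L \<longleftrightarrow> capable K M"
  unfolding capable_def
  using lie_isomorphic_trans[OF assms(2)] lie_isomorphic_trans[OF lie_isomorphic_sym[OF assms]]
  by blast

lemma fin_dim_lie_algebra_cong:
  assumes L: "fin_dim_lie_algebra K L" and M: "lie_algebra K M" and iso: "lie_isomorphic K L M"
  shows "fin_dim_lie_algebra K M"
proof -
  interpret L: fin_dim_lie_algebra K L by (fact L)
  interpret M: lie_algebra K M by (fact M)
  obtain f where f: "f \<in> module_hom K L M" "f ` carrier L = carrier M"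
    using iso by (auto simp: lie_isomorphic_def bij_betw_def)
  have "linear_map K L M f"
    by unfold_locales (fact f)
  then have "M.fin_dim"
    using linear_map.rank_nullity_main(2) L.fin_dim f(2) by blast
  then show ?thesis by unfold_locales
qed

section \<open>Surjections whose kernel is the centre\<close>

text \<open>A surjective homomorphism of Lie algebras \<open>E \<rightarrow> L\<close> with kernel \<open>Z(E)\<close>.  Such a map amounts to an
  isomorphism \<open>L \<cong> E/Z(E)\<close> and spares the computation with cosets.\<close>

locale center_quotient_map =
  E: lie_algebra K E + L: lie_algebra K L + mod_hom K E L \<pi>
  for K and E :: "('a, 'e, 'p) lie_algebra_scheme" and L :: "('a, 'b, 'q) lie_algebra_scheme"
    and \<pi> +
  assumes onto: "\<pi> ` carrier E = carrier L"
    and hom_bracket: "\<lbrakk>x \<in> carrier E; y \<in> carrier E\<rbrakk> \<Longrightarrow> \<pi> \<lbrakk>x, y\<rbrakk>\<^bsub>E\<^esub> = \<lbrakk>\<pi> x, \<pi> y\<rbrakk>\<^bsub>L\<^esub>"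
    and kernel: "x \<in> carrier E \<Longrightarrow> \<pi> x = \<zero>\<^bsub>L\<^esub> \<longleftrightarrow> x \<in> lie_center E"

context lie_algebra
begin

lemma carrier_lie_quotient:
  "carrier (lie_quotient L (lie_center L)) = (\<lambda>x. lie_center L +> x) ` carrier L"
  by (auto simp: lie_quotient_def A_RCOSETS_def RCOSETS_def a_r_coset_def)

lemma center_coset_eq_iff:
  assumes "x \<in> carrier L" "y \<in> carrier L"
  shows "lie_center L +> x = lie_center L +> y \<longleftrightarrow> x \<ominus> y \<in> lie_center L"
proof -
  interpret Z: abelian_subgroup "lie_center L" L by (rule center_abelian_subgroup)
  show ?thesis
    unfolding M.minus_eq Z.a_rcos_module[OF assms(2,1), symmetric]
    using Z.a_repr_independence'[OF _ assms(2), of x] Z.a_rcos_self[OF assms(1)]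
    by metis
qed

lemma center_cosetE:
  assumes "x' \<in> lie_center L +> x"
  obtains h where "h \<in> lie_center L" "h \<in> carrier L" "x' = h \<oplus> x"
  using assms center_closed by (auto simp: a_r_coset_def')

lemma center_coset_add_center:
  assumes "h \<in> lie_center L" "x \<in> carrier L"
  shows "lie_center L +> (h \<oplus> x) = lie_center L +> x"
proof -
  have "h \<oplus> x \<ominus> x = h" using assms center_closed by (auto simp: M.minus_eq M.a_assoc M.r_neg)
  then show ?thesis using assms center_closed by (subst center_coset_eq_iff) auto
qed

lemma lie_quotient_add:
  assumes "x \<in> carrier L" "y \<in> carrier L"
  shows "(lie_center L +> x) \<oplus>\<^bsub>lie_quotient L (lie_center L)\<^esub> (lie_center L +> y)
    = lie_center L +> (x \<oplus> y)"
proof -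
  interpret Z: abelian_subgroup "lie_center L" L by (rule center_abelian_subgroup)
  show ?thesis using Z.a_rcos_sum[OF assms] by (simp add: lie_quotient_def)
qed

lemma lie_quotient_smult:
  assumes "a \<in> carrier K" "x \<in> carrier L"
  shows "a \<odot>\<^bsub>lie_quotient L (lie_center L)\<^esub> (lie_center L +> x) = lie_center L +> (a \<odot> x)"
proof -
  interpret Z: abelian_subgroup "lie_center L" L by (rule center_abelian_subgroup)
  show ?thesis
    unfolding lie_quotient_def lie_algebra.simps module.simps
  proof (rule SUP_eq_const)
    show "lie_center L +> x \<noteq> {}" using Z.a_rcos_self[OF assms(2)] by blast
    fix x' assume "x' \<in> lie_center L +> x"
    then obtain h where h: "h \<in> lie_center L" "h \<in> carrier L" "x' = h \<oplus> x"
      by (rule center_cosetE)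
    then show "lie_center L +> (a \<odot> x') = lie_center L +> (a \<odot> x)"
      using center_coset_add_center[OF center_smult[OF assms(1) h(1)], of "a \<odot> x"] assms
      by (simp add: smult_r_distr)
  qed
qed

lemma lie_quotient_bracket:
  assumes "x \<in> carrier L" "y \<in> carrier L"
  shows "\<lbrakk>lie_center L +> x, lie_center L +> y\<rbrakk>\<^bsub>lie_quotient L (lie_center L)\<^esub>
    = lie_center L +> \<lbrakk>x, y\<rbrakk>"
proof -
  interpret Z: abelian_subgroup "lie_center L" L by (rule center_abelian_subgroup)
  show ?thesis
    unfolding lie_quotient_def lie_algebra.simps
  proof (intro SUP_eq_const)
    show "lie_center L +> x \<noteq> {}" "lie_center L +> y \<noteq> {}"
      using Z.a_rcos_self assms by blast+
    fix x' y' assume "x' \<in> lie_center L +> x" "y' \<in> lie_center L +> y"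
    then obtain h k where "h \<in> lie_center L" "h \<in> carrier L" "x' = h \<oplus> x"
        "k \<in> lie_center L" "k \<in> carrier L" "y' = k \<oplus> y"
      by (elim center_cosetE)
    then show "lie_center L +> \<lbrakk>x', y'\<rbrakk> = lie_center L +> \<lbrakk>x, y\<rbrakk>"
      using assms
      by (simp add: bracket_add_left bracket_add_right center_bracket_left center_bracket_right)
  qed
qed

end

context center_quotient_map
begin

lemma lie_isomorphic_quotient: "lie_isomorphic K L (lie_quotient E (lie_center E))"
proof -
  let ?Q = "lie_quotient E (lie_center E)" and ?c = "\<lambda>x. lie_center E +>\<^bsub>E\<^esub> x"
  define s where "s l = inv_into (carrier E) \<pi> l" for l
  have s: "s l \<in> carrier E" "\<pi> (s l) = l" if "l \<in> carrier L" for l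
    using that onto by (auto simp: s_def inv_into_into f_inv_into_f)
  have eq: "?c x = ?c y \<longleftrightarrow> \<pi> x = \<pi> y" if "x \<in> carrier E" "y \<in> carrier E" for x y
  proof -
    have "\<pi> (x \<ominus>\<^bsub>E\<^esub> y) = \<zero>\<^bsub>L\<^esub> \<longleftrightarrow> \<pi> x = \<pi> y"
      using that by simp
    then show ?thesis
      using that kernel[of "x \<ominus>\<^bsub>E\<^esub> y"] by (simp add: E.center_coset_eq_iff)
  qed
  have inj: "inj_on (\<lambda>l. ?c (s l)) (carrier L)"
    by (rule inj_onI) (metis eq s)
  have c_s: "?c (s (\<pi> x)) = ?c x" if "x \<in> carrier E" for x
    using that s by (subst eq) auto
  have "(\<lambda>l. ?c (s l)) ` carrier L = (\<lambda>x. ?c (s (\<pi> x))) ` carrier E"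
    unfolding onto[symmetric] image_image ..
  also have "\<dots> = carrier ?Q"
    unfolding E.carrier_lie_quotient using c_s by (rule image_cong[OF refl])
  finally have im: "(\<lambda>l. ?c (s l)) ` carrier L = carrier ?Q" .
  have "?c (s (l \<oplus>\<^bsub>L\<^esub> l')) = ?c (s l) \<oplus>\<^bsub>?Q\<^esub> ?c (s l')"
    if "l \<in> carrier L" "l' \<in> carrier L" for l l'
    using that c_s[of "s l \<oplus>\<^bsub>E\<^esub> s l'"] by (simp add: s E.lie_quotient_add)
  moreover have "?c (s (a \<odot>\<^bsub>L\<^esub> l)) = a \<odot>\<^bsub>?Q\<^esub> ?c (s l)"
    if "a \<in> carrier K" "l \<in> carrier L" for a l
    using that c_s[of "a \<odot>\<^bsub>E\<^esub> s l"] by (simp add: s E.lie_quotient_smult)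
  moreover have "?c (s \<lbrakk>l, l'\<rbrakk>\<^bsub>L\<^esub>) = \<lbrakk>?c (s l), ?c (s l')\<rbrakk>\<^bsub>?Q\<^esub>"
    if "l \<in> carrier L" "l' \<in> carrier L" for l l'
    using that c_s[of "\<lbrakk>s l, s l'\<rbrakk>\<^bsub>E\<^esub>"] by (simp add: s E.lie_quotient_bracket hom_bracket)
  moreover have "(\<lambda>l. ?c (s l)) \<in> carrier L \<rightarrow> carrier ?Q"
    using im by blast
  ultimately show ?thesis
    unfolding lie_isomorphic_def using inj im
    by (intro bexI[of _ "\<lambda>l. ?c (s l)"]) (auto simp: module_hom_def bij_betw_def)
qed

end

lemma center_quotient_map_exists:
  assumes E: "lie_algebra K E" and L: "lie_algebra K L"
    and iso: "lie_isomorphic K L (lie_quotient E (lie_center E))"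
  obtains \<pi> where "center_quotient_map K E L \<pi>"
proof -
  interpret E: lie_algebra K E by (fact E)
  interpret L: lie_algebra K L by (fact L)
  let ?Q = "lie_quotient E (lie_center E)" and ?c = "\<lambda>x. lie_center E +>\<^bsub>E\<^esub> x"
  obtain f where hom: "f \<in> module_hom K L ?Q" and bij: "bij_betw f (carrier L) (carrier ?Q)"
      and br: "\<And>x y. x \<in> carrier L \<Longrightarrow> y \<in> carrier L \<Longrightarrow> f \<lbrakk>x, y\<rbrakk>\<^bsub>L\<^esub> = \<lbrakk>f x, f y\<rbrakk>\<^bsub>?Q\<^esub>"
    using iso unfolding lie_isomorphic_def by blast
  have ad: "\<And>x y. x \<in> carrier L \<Longrightarrow> y \<in> carrier L \<Longrightarrow> f (x \<oplus>\<^bsub>L\<^esub> y) = f x \<oplus>\<^bsub>?Q\<^esub> f y"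
    and sm: "\<And>a x. a \<in> carrier K \<Longrightarrow> x \<in> carrier L \<Longrightarrow> f (a \<odot>\<^bsub>L\<^esub> x) = a \<odot>\<^bsub>?Q\<^esub> f x"
    using hom by (auto simp: module_hom_def)
  define \<pi> where "\<pi> x = inv_into (carrier L) f (?c x)" for x
  have cQ: "?c x \<in> f ` carrier L" if "x \<in> carrier E" for x
    using that bij by (simp add: bij_betw_def E.carrier_lie_quotient)
  have cl: "\<pi> x \<in> carrier L" and f\<pi>: "f (\<pi> x) = ?c x" if "x \<in> carrier E" for x
    using cQ[OF that] by (auto simp: \<pi>_def inv_into_into f_inv_into_f)
  have \<pi>I: "\<pi> x = l" if "x \<in> carrier E" "l \<in> carrier L" "f l = ?c x" for x l
    using that bij by (metis \<pi>_def bij_betw_def inv_into_f_f)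
  have add: "\<pi> (x \<oplus>\<^bsub>E\<^esub> y) = \<pi> x \<oplus>\<^bsub>L\<^esub> \<pi> y" if "x \<in> carrier E" "y \<in> carrier E" for x y
    using that by (intro \<pi>I) (simp_all add: cl f\<pi> ad E.lie_quotient_add)
  have smult: "\<pi> (a \<odot>\<^bsub>E\<^esub> x) = a \<odot>\<^bsub>L\<^esub> \<pi> x" if "a \<in> carrier K" "x \<in> carrier E" for a x
    using that by (intro \<pi>I) (simp_all add: cl f\<pi> sm E.lie_quotient_smult)
  have bracket: "\<pi> \<lbrakk>x, y\<rbrakk>\<^bsub>E\<^esub> = \<lbrakk>\<pi> x, \<pi> y\<rbrakk>\<^bsub>L\<^esub>" if "x \<in> carrier E" "y \<in> carrier E" for x y
    using that by (intro \<pi>I) (simp_all add: cl f\<pi> br E.lie_quotient_bracket)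
  have "\<pi> \<in> module_hom K E L"
    using cl add smult by (auto simp: module_hom_def)
  then interpret mod_hom K E L \<pi>
    by unfold_locales
  have onto: "\<pi> ` carrier E = carrier L"
  proof (intro equalityI subsetI)
    fix l assume l: "l \<in> carrier L"
    then have "f l \<in> carrier ?Q" using bij by (auto simp: bij_betw_def)
    then obtain x where "x \<in> carrier E" "f l = ?c x" by (auto simp: E.carrier_lie_quotient)
    with l show "l \<in> \<pi> ` carrier E" using \<pi>I by blast
  qed (use cl in blast)
  have kernel: "\<pi> x = \<zero>\<^bsub>L\<^esub> \<longleftrightarrow> x \<in> lie_center E" if x: "x \<in> carrier E" for x
  proof -
    have "\<pi> x = \<zero>\<^bsub>L\<^esub> \<longleftrightarrow> \<pi> x = \<pi> \<zero>\<^bsub>E\<^esub>" by simp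
    also have "\<dots> \<longleftrightarrow> ?c x = ?c \<zero>\<^bsub>E\<^esub>"
      using f\<pi>[OF x] f\<pi>[OF E.M.zero_closed] by (metis \<pi>_def)
    also have "\<dots> \<longleftrightarrow> x \<in> lie_center E"
      using x by (simp add: E.center_coset_eq_iff E.M.minus_eq)
    finally show ?thesis .
  qed
  show thesis
    by (rule that, unfold_locales) (fact onto bracket kernel)+
qed

section \<open>An obstruction to capability\<close>

text \<open>By the Jacobi identity: \<open>[x, u]\<close> and \<open>[y, u]\<close> lie in \<open>Z(E)\<close>.\<close>

lemma (in center_quotient_map) bracket_lift_commutes:
  assumes "x \<in> carrier E" "y \<in> carrier E" "u \<in> carrier E"
    and "\<lbrakk>\<pi> x, \<pi> u\<rbrakk>\<^bsub>L\<^esub> = \<zero>\<^bsub>L\<^esub>" "\<lbrakk>\<pi> y, \<pi> u\<rbrakk>\<^bsub>L\<^esub> = \<zero>\<^bsub>L\<^esub>"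
  shows "\<lbrakk>u, \<lbrakk>x, y\<rbrakk>\<^bsub>E\<^esub>\<rbrakk>\<^bsub>E\<^esub> = \<zero>\<^bsub>E\<^esub>"
proof -
  have "\<lbrakk>\<pi> u, \<pi> x\<rbrakk>\<^bsub>L\<^esub> = \<zero>\<^bsub>L\<^esub>"
    using assms L.bracket_skew[of "\<pi> u" "\<pi> x"] by simp
  then have "\<lbrakk>u, x\<rbrakk>\<^bsub>E\<^esub> \<in> lie_center E" "\<lbrakk>y, u\<rbrakk>\<^bsub>E\<^esub> \<in> lie_center E"
    using assms kernel[of "\<lbrakk>u, x\<rbrakk>\<^bsub>E\<^esub>"] kernel[of "\<lbrakk>y, u\<rbrakk>\<^bsub>E\<^esub>"] by (simp_all add: hom_bracket)
  then have "\<lbrakk>y, \<lbrakk>u, x\<rbrakk>\<^bsub>E\<^esub>\<rbrakk>\<^bsub>E\<^esub> = \<zero>\<^bsub>E\<^esub>" "\<lbrakk>x, \<lbrakk>y, u\<rbrakk>\<^bsub>E\<^esub>\<rbrakk>\<^bsub>E\<^esub> = \<zero>\<^bsub>E\<^esub>"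
    using assms by (simp_all add: E.center_bracket_right)
  then show ?thesis
    using E.jacobi[of x y u] assms by simp
qed

text \<open>If every vector is a sum of one that commutes with \<open>x, y\<close> and one that commutes with \<open>x', y'\<close>,
  then all lifts of \<open>[x, y] = [x', y']\<close> are central: the bracket of the lifts of \<open>x, y\<close> commutes with
  the lifts of the first summands, and that of the lifts of \<open>x', y'\<close> with the lifts of the second ones.\<close>

lemma capable_bracket_eq_zero:
  fixes L :: "('a, 'b, 'p) lie_algebra_scheme"
  assumes L: "lie_algebra K L" and "capable K L"
    and car: "x \<in> carrier L" "y \<in> carrier L" "x' \<in> carrier L" "y' \<in> carrier L"
    and eq: "\<lbrakk>x, y\<rbrakk>\<^bsub>L\<^esub> = \<lbrakk>x', y'\<rbrakk>\<^bsub>L\<^esub>"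
    and split: "\<And>w. w \<in> carrier L \<Longrightarrow> \<exists>u \<in> carrier L. \<exists>v \<in> carrier L. w = u \<oplus>\<^bsub>L\<^esub> v \<and>
      \<lbrakk>x, u\<rbrakk>\<^bsub>L\<^esub> = \<zero>\<^bsub>L\<^esub> \<and> \<lbrakk>y, u\<rbrakk>\<^bsub>L\<^esub> = \<zero>\<^bsub>L\<^esub> \<and> \<lbrakk>x', v\<rbrakk>\<^bsub>L\<^esub> = \<zero>\<^bsub>L\<^esub> \<and> \<lbrakk>y', v\<rbrakk>\<^bsub>L\<^esub> = \<zero>\<^bsub>L\<^esub>"
  shows "\<lbrakk>x, y\<rbrakk>\<^bsub>L\<^esub> = \<zero>\<^bsub>L\<^esub>"
proof -
  obtain E :: "('a, nat \<Rightarrow> 'a) lie_algebra" where E: "lie_algebra K E"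
      and iso: "lie_isomorphic K L (lie_quotient E (lie_center E))"
    using assms(2) unfolding capable_def fin_dim_lie_algebra_def by blast
  obtain \<pi> where "center_quotient_map K E L \<pi>"
    using center_quotient_map_exists[OF E L iso] .
  then interpret center_quotient_map K E L \<pi> .
  have "\<exists>X \<in> carrier E. \<pi> X = l" if "l \<in> carrier L" for l
    using that onto by (metis imageE)
  then obtain X Y X' Y' where lift: "X \<in> carrier E" "\<pi> X = x" "Y \<in> carrier E" "\<pi> Y = y"
      "X' \<in> carrier E" "\<pi> X' = x'" "Y' \<in> carrier E" "\<pi> Y' = y'"
    using car by metis
  define Z where "Z = \<lbrakk>X, Y\<rbrakk>\<^bsub>E\<^esub>"
  define h where "h = Z \<ominus>\<^bsub>E\<^esub> \<lbrakk>X', Y'\<rbrakk>\<^bsub>E\<^esub>"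
  have Z: "Z \<in> carrier E" using lift by (simp add: Z_def)
  have hc: "h \<in> carrier E" using lift Z by (simp add: h_def)
  have "\<pi> h = \<zero>\<^bsub>L\<^esub>"
    using lift car eq by (simp add: h_def Z_def hom_bracket L.M.r_neg L.M.minus_eq)
  then have h: "h \<in> lie_center E"
    using kernel[OF hc] by simp
  have Z': "Z = h \<oplus>\<^bsub>E\<^esub> \<lbrakk>X', Y'\<rbrakk>\<^bsub>E\<^esub>"
    using lift Z by (simp add: h_def E.M.minus_eq E.M.a_assoc E.M.l_neg)
  have "\<lbrakk>W, Z\<rbrakk>\<^bsub>E\<^esub> = \<zero>\<^bsub>E\<^esub>" if W: "W \<in> carrier E" for W
  proof -
    obtain u v where uv: "u \<in> carrier L" "v \<in> carrier L" "\<pi> W = u \<oplus>\<^bsub>L\<^esub> v"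
        "\<lbrakk>x, u\<rbrakk>\<^bsub>L\<^esub> = \<zero>\<^bsub>L\<^esub>" "\<lbrakk>y, u\<rbrakk>\<^bsub>L\<^esub> = \<zero>\<^bsub>L\<^esub>" "\<lbrakk>x', v\<rbrakk>\<^bsub>L\<^esub> = \<zero>\<^bsub>L\<^esub>" "\<lbrakk>y', v\<rbrakk>\<^bsub>L\<^esub> = \<zero>\<^bsub>L\<^esub>"
      using split[of "\<pi> W"] W by auto
    obtain U where U: "U \<in> carrier E" "\<pi> U = u"
      using uv(1) onto by (metis imageE)
    define V where "V = \<ominus>\<^bsub>E\<^esub> U \<oplus>\<^bsub>E\<^esub> W"
    have V: "V \<in> carrier E" using U W by (simp add: V_def)
    have "\<pi> V = v"
      using U W uv(1,2,3) by (simp add: V_def L.M.r_neg1)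
    then have "\<lbrakk>V, \<lbrakk>X', Y'\<rbrakk>\<^bsub>E\<^esub>\<rbrakk>\<^bsub>E\<^esub> = \<zero>\<^bsub>E\<^esub>"
      using bracket_lift_commutes[of X' Y' V] lift V uv by simp
    then have "\<lbrakk>V, Z\<rbrakk>\<^bsub>E\<^esub> = \<zero>\<^bsub>E\<^esub>"
      unfolding Z' using V hc h lift by (simp add: E.bracket_add_right E.center_bracket_right)
    moreover have "\<lbrakk>U, Z\<rbrakk>\<^bsub>E\<^esub> = \<zero>\<^bsub>E\<^esub>"
      using bracket_lift_commutes[of X Y U] lift U uv by (simp add: Z_def)
    moreover have "W = U \<oplus>\<^bsub>E\<^esub> V"
      using U W by (simp add: V_def E.M.r_neg2)
    ultimately show ?thesis
      using U V Z by (simp add: E.bracket_add_left)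
  qed
  then have "Z \<in> lie_center E"
    using Z E.bracket_skew[OF Z] by (simp add: lie_center_def)
  then show ?thesis
    using kernel[OF Z] lift by (simp add: Z_def hom_bracket)
qed

section \<open>Lie algebras with an abelian ideal of codimension one\<close>

lemma fin_dim_of_two_images:
  assumes f: "linear_map K U V f" and g: "linear_map K W V g"
    and fd: "vectorspace.fin_dim K U" "vectorspace.fin_dim K W"
    and gen: "\<And>v. v \<in> carrier V \<Longrightarrow> \<exists>u \<in> carrier U. \<exists>w \<in> carrier W. v = f u \<oplus>\<^bsub>V\<^esub> g w"
  shows "vectorspace.fin_dim K V"
proof -
  interpret f: linear_map K U V f by (fact f)
  interpret g: linear_map K W V g by (fact g)
  obtain A where A: "finite A" "A \<subseteq> carrier U" "f.V.module.span A = carrier U"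
    using fd(1) unfolding f.V.fin_dim_def by blast
  obtain B where B: "finite B" "B \<subseteq> carrier W" "g.V.module.span B = carrier W"
    using fd(2) unfolding g.V.fin_dim_def by blast
  let ?S = "f.W.module.span (f ` A \<union> g ` B)"
  have sub: "f ` A \<union> g ` B \<subseteq> carrier V" using A B by auto
  interpret S: submodule K ?S V by (rule f.W.module.span_is_submodule[OF sub])
  have in_S: "f ` A \<union> g ` B \<subseteq> ?S" by (rule f.W.module.in_own_span[OF sub])
  have "submodule K {u \<in> carrier U. f u \<in> ?S} U"
    by unfold_locales (auto)
  then have "f.V.module.span A \<subseteq> {u \<in> carrier U. f u \<in> ?S}"
    using A in_S by (intro f.V.module.span_is_subset) auto
  then have fS: "f u \<in> ?S" if "u \<in> carrier U" for u using that A by blast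
  have "submodule K {u \<in> carrier W. g u \<in> ?S} W"
    by unfold_locales (auto)
  then have "g.V.module.span B \<subseteq> {u \<in> carrier W. g u \<in> ?S}"
    using B in_S by (intro g.V.module.span_is_subset) auto
  then have gS: "g w \<in> ?S" if "w \<in> carrier W" for w using that B by blast
  have "carrier V \<subseteq> ?S"
    using gen fS gS by fastforce
  then have "?S = carrier V" using f.W.module.span_is_subset2[OF sub] by blast
  then show ?thesis
    unfolding f.W.fin_dim_def using A B sub by (intro exI[of _ "f ` A \<union> g ` B"]) auto
qed

text \<open>The ideal is given as the kernel of the linear functional \<open>\<phi>\<close>.  The vector \<open>e\<close> spans a complement,
  and \<open>v\<^sub>0\<close> witnesses that the ideal is not zero.  This last condition is needed, since the
  one-dimensional Lie algebra is not capable.\<close>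

locale codim_one_abelian_ideal = fin_dim_lie_algebra K L
  for K and L :: "('a, 'b, 'p) lie_algebra_scheme" (structure) +
  fixes \<phi> :: "'b \<Rightarrow> 'a" and e v\<^sub>0 :: 'b
  assumes \<phi>_closed [simp, intro]: "x \<in> carrier L \<Longrightarrow> \<phi> x \<in> carrier K"
    and \<phi>_add [simp]: "\<lbrakk>x \<in> carrier L; y \<in> carrier L\<rbrakk> \<Longrightarrow> \<phi> (x \<oplus> y) = \<phi> x \<oplus>\<^bsub>K\<^esub> \<phi> y"
    and \<phi>_smult [simp]: "\<lbrakk>a \<in> carrier K; x \<in> carrier L\<rbrakk> \<Longrightarrow> \<phi> (a \<odot> x) = a \<otimes>\<^bsub>K\<^esub> \<phi> x"
    and \<phi>_bracket [simp]: "\<lbrakk>x \<in> carrier L; y \<in> carrier L\<rbrakk> \<Longrightarrow> \<phi> \<lbrakk>x, y\<rbrakk> = \<zero>\<^bsub>K\<^esub>"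
    and kernel_abelian: "\<lbrakk>x \<in> carrier L; y \<in> carrier L; \<phi> x = \<zero>\<^bsub>K\<^esub>; \<phi> y = \<zero>\<^bsub>K\<^esub>\<rbrakk> \<Longrightarrow> \<lbrakk>x, y\<rbrakk> = \<zero>"
    and e: "e \<in> carrier L" "\<phi> e = \<one>\<^bsub>K\<^esub>"
    and v\<^sub>0: "v\<^sub>0 \<in> carrier L" "\<phi> v\<^sub>0 = \<zero>\<^bsub>K\<^esub>" "v\<^sub>0 \<noteq> \<zero>"
begin

lemma bracket_formula:
  assumes x: "x \<in> carrier L" and y: "y \<in> carrier L"
  shows "\<lbrakk>x, y\<rbrakk> = \<phi> x \<odot> \<lbrakk>e, y\<rbrakk> \<ominus> \<phi> y \<odot> \<lbrakk>e, x\<rbrakk>"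
proof -
  \<comment> \<open>The components of \<open>x\<close> and \<open>y\<close> in the kernel of \<open>\<phi>\<close>.\<close>
  define x' y' where "x' = x \<oplus> (\<ominus>\<^bsub>K\<^esub> \<phi> x) \<odot> e" and "y' = y \<oplus> (\<ominus>\<^bsub>K\<^esub> \<phi> y) \<odot> e"
  have c: "x' \<in> carrier L" "y' \<in> carrier L"
    using x y e by (auto simp: x'_def y'_def)
  have "\<phi> x' = \<zero>\<^bsub>K\<^esub>" "\<phi> y' = \<zero>\<^bsub>K\<^esub>"
    using x y e by (simp_all add: x'_def y'_def R.r_neg)
  then have 0: "\<lbrakk>x', y'\<rbrakk> = \<zero>" using c kernel_abelian by blast
  have x_eq: "x = \<phi> x \<odot> e \<oplus> x'"
    using x e by (simp add: x'_def smult_l_minus M.a_lcomm[of "\<phi> x \<odot> e" x] M.r_neg)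
  have y_eq: "y = \<phi> y \<odot> e \<oplus> y'"
    using y e by (simp add: y'_def smult_l_minus M.a_lcomm[of "\<phi> y \<odot> e" y] M.r_neg)
  have ex: "\<lbrakk>e, x\<rbrakk> = \<lbrakk>e, x'\<rbrakk>" using c e x by (subst x_eq) (simp add: bracket_add_right bracket_smult_right)
  have ey: "\<lbrakk>e, y\<rbrakk> = \<lbrakk>e, y'\<rbrakk>" using c e y by (subst y_eq) (simp add: bracket_add_right bracket_smult_right)
  have "\<lbrakk>x, y\<rbrakk> = \<phi> x \<odot> \<lbrakk>e, y\<rbrakk> \<oplus> \<lbrakk>x', y\<rbrakk>"
    using c e x y by (subst x_eq) (simp add: bracket_add_left bracket_smult_left)
  also have "\<lbrakk>x', y\<rbrakk> = \<phi> y \<odot> \<lbrakk>x', e\<rbrakk>"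
    using c e y 0 by (subst y_eq) (simp add: bracket_add_right bracket_smult_right)
  also have "\<lbrakk>x', e\<rbrakk> = \<ominus> \<lbrakk>e, x\<rbrakk>"
    using c e ex bracket_skew[of x' e] by simp
  finally show ?thesis
    using x y e by (simp add: M.minus_eq smult_r_minus)
qed

lemma smult_swap:
  assumes "a \<in> carrier K" "b \<in> carrier K" "x \<in> carrier L"
  shows "a \<odot> (b \<odot> x) = b \<odot> (a \<odot> x)"
  using assms by (metis R.m_comm smult_assoc1)

text \<open>By \<open>bracket_formula\<close> the left-hand side becomes a cyclic sum of six terms that cancel in
  pairs.  It is the only part of the Jacobi identity of the extension below that does not come from
  \<open>L\<close>, as \<open>\<phi>\<close> vanishes on brackets.\<close>

lemma cocycle:
  assumes "x \<in> carrier L" "y \<in> carrier L" "z \<in> carrier L"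
  shows "\<phi> x \<odot> \<lbrakk>y, z\<rbrakk> \<oplus> \<phi> y \<odot> \<lbrakk>z, x\<rbrakk> \<oplus> \<phi> z \<odot> \<lbrakk>x, y\<rbrakk> = \<zero>"
proof -
  have cancel: "(p \<ominus> q) \<oplus> (r \<ominus> p) \<oplus> (q \<ominus> r) = \<zero>"
    if "p \<in> carrier L" "q \<in> carrier L" "r \<in> carrier L" for p q r
    using that by (simp add: M.minus_eq M.a_ac M.r_neg M.r_neg1 M.r_neg2)
  have *: "\<phi> a \<odot> \<lbrakk>b, c\<rbrakk> = \<phi> a \<odot> (\<phi> b \<odot> \<lbrakk>e, c\<rbrakk>) \<ominus> \<phi> c \<odot> (\<phi> a \<odot> \<lbrakk>e, b\<rbrakk>)"
    if "a \<in> carrier L" "b \<in> carrier L" "c \<in> carrier L" for a b c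
    using that e bracket_formula[of b c] smult_swap[of "\<phi> a" "\<phi> c" "\<lbrakk>e, b\<rbrakk>"]
    by (simp add: M.minus_eq smult_r_distr smult_r_minus)
  show ?thesis
    unfolding *[OF assms] *[OF assms(2,3,1)] *[OF assms(3,1,2)]
    using assms e by (intro cancel) auto
qed

text \<open>The central extension of \<open>L\<close> by the vector space \<open>L\<close> with the cocycle
  \<open>(l, l') \<mapsto> \<phi>(l) l' - \<phi>(l') l\<close>: the second components of the arguments play no role in the bracket.\<close>

definition double :: "('a, 'b \<times> 'b) lie_algebra"
  where "double = add_bracket (direct_sum L L)
    (\<lambda>u v. (\<lbrakk>fst u, fst v\<rbrakk>, \<phi> (fst u) \<odot> fst v \<ominus> \<phi> (fst v) \<odot> fst u))"

lemma double_simps [simp]: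
  "carrier double = carrier L \<times> carrier L"
  "\<zero>\<^bsub>double\<^esub> = (\<zero>, \<zero>)"
  "u \<oplus>\<^bsub>double\<^esub> v = (fst u \<oplus> fst v, snd u \<oplus> snd v)"
  "a \<odot>\<^bsub>double\<^esub> u = (a \<odot> fst u, a \<odot> snd u)"
  "\<lbrakk>u, v\<rbrakk>\<^bsub>double\<^esub> = (\<lbrakk>fst u, fst v\<rbrakk>, \<phi> (fst u) \<odot> fst v \<ominus> \<phi> (fst v) \<odot> fst u)"
  by (auto simp: double_def direct_sum_def module.defs lie_algebra.defs split: prod.splits)

lemma double_vectorspace: "vectorspace K double"
  unfolding double_def
  by (intro vectorspace.intro module_add_bracket direct_sum_is_module module_axioms field_axioms)

lemma double_lie_algebra: "lie_algebra K double"
proof -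
  interpret D: vectorspace K double by (rule double_vectorspace)
  show ?thesis
  proof (unfold_locales, goal_cases)
    case (1 x y) then show ?case by auto
  next
    case (2 x y z) then show ?case
      by (auto simp: bracket_add_left smult_l_distr smult_r_distr M.minus_eq M.minus_add M.a_ac)
  next
    case (3 x y z) then show ?case
      by (auto simp: bracket_add_right smult_l_distr smult_r_distr M.minus_eq M.minus_add M.a_ac)
  next
    case (4 a x y) then show ?case
      by (auto simp: bracket_smult_left smult_assoc1 smult_r_distr smult_r_minus M.minus_eq
          smult_swap[of a])
  next
    case (5 a x y) then show ?case
      by (auto simp: bracket_smult_right smult_assoc1 smult_r_distr smult_r_minus M.minus_eq
          smult_swap[of a])
  next
    case (6 x) then show ?case by (auto simp: M.r_neg M.minus_eq)
  next
    case (7 x y z)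
    then show ?case by (auto simp: jacobi cocycle M.minus_eq)
  qed
qed

lemma double_fin_dim: "vectorspace.fin_dim K double"
proof (rule fin_dim_of_two_images)
  interpret D: vectorspace K double by (rule double_vectorspace)
  show "linear_map K L double (\<lambda>x. (x, \<zero>))" "linear_map K L double (\<lambda>x. (\<zero>, x))"
    by (unfold_locales; auto simp: module_hom_def)+
qed (use fin_dim in auto)

text \<open>If \<open>\<phi>(l) x = \<phi>(x) l\<close> for all \<open>x\<close>, then \<open>x = v\<^sub>0\<close> gives \<open>\<phi>(l) = 0\<close>, and then \<open>x = e\<close> gives
  \<open>l = 0\<close>.\<close>

lemma double_center: "lie_center double = {\<zero>} \<times> carrier L"
proof (intro equalityI subsetI)
  fix u assume u: "u \<in> lie_center double"
  then have c: "fst u \<in> carrier L" "snd u \<in> carrier L" by (auto simp: lie_center_def)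
  have *: "\<phi> (fst u) \<odot> x = \<phi> x \<odot> fst u" if "x \<in> carrier L" for x
  proof -
    have "\<lbrakk>u, (x, \<zero>)\<rbrakk>\<^bsub>double\<^esub> = \<zero>\<^bsub>double\<^esub>"
      using u that by (simp add: lie_center_def del: double_simps(5))
    then show ?thesis using c that by simp
  qed
  have "\<phi> (fst u) \<odot> v\<^sub>0 = \<zero>" using *[of v\<^sub>0] v\<^sub>0 c by simp
  then have "\<phi> (fst u) = \<zero>\<^bsub>K\<^esub>"
    using v\<^sub>0 c mult_inverse[of "\<phi> (fst u)" v\<^sub>0 \<zero>] by auto
  then have "fst u = \<zero>" using *[of e] e c by simp
  then show "u \<in> {\<zero>} \<times> carrier L" using c by (cases u) auto
next
  have "\<phi> \<zero> = \<zero>\<^bsub>K\<^esub>" using \<phi>_smult[of "\<zero>\<^bsub>K\<^esub>" \<zero>] by simp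
  moreover fix u assume "u \<in> {\<zero>} \<times> carrier L"
  ultimately show "u \<in> lie_center double"
    by (auto simp: lie_center_def)
qed

proposition capable_codim_one: "capable K L"
proof (rule capableI)
  interpret D: lie_algebra K double by (rule double_lie_algebra)
  show "fin_dim_lie_algebra K double"
    by unfold_locales (rule double_fin_dim)
  interpret mod_hom K double L fst
    by unfold_locales (auto simp: module_hom_def)
  have "center_quotient_map K double L fst"
    by unfold_locales (auto simp: double_center)
  then show "lie_isomorphic K L (lie_quotient double (lie_center double))"
    by (rule center_quotient_map.lie_isomorphic_quotient)
qed

end

section \<open>The Lie algebra \<open>H(m) \<oplus> A(k)\<close>\<close>

locale heisenberg_abelian_sum = field K for K :: "('a, 'r) ring_scheme" (structure) +
  fixes m k :: nat
begin

abbreviation HA :: "('a, (heisenberg_index \<Rightarrow> 'a) \<times> (nat \<Rightarrow> 'a)) lie_algebra"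
  where "HA \<equiv> lie_direct_sum (heisenberg K m) (abelian_lie_algebra K k)"

abbreviation \<X> where "\<X> \<equiv> heisenberg_index.X"
abbreviation \<Y> where "\<Y> \<equiv> heisenberg_index.Y"
abbreviation \<Z> where "\<Z> \<equiv> heisenberg_index.Z"

text \<open>The alternating form on \<open>H(m)\<close> with \<open>[u, v] = symp(u, v) z\<close>.\<close>

definition symp :: "(heisenberg_index \<Rightarrow> 'a) \<Rightarrow> (heisenberg_index \<Rightarrow> 'a) \<Rightarrow> 'a"
  where "symp u v = (\<Oplus>i \<in> {1..m}. u (\<X> i) \<otimes> v (\<Y> i) \<ominus> u (\<Y> i) \<otimes> v (\<X> i))"

text \<open>The multiple \<open>c z\<close> of the central basis vector of \<open>H(m)\<close>, in the direct sum.\<close>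

definition central :: "'a \<Rightarrow> (heisenberg_index \<Rightarrow> 'a) \<times> (nat \<Rightarrow> 'a)"
  where "central c = (\<lambda>j \<in> heisenberg_indices m. if j = \<Z> then c else \<zero>, \<lambda>_ \<in> {1..k}. \<zero>)"

text \<open>The distinguished basis of \<open>H(m)\<close>, in the direct sum.\<close>

definition basis :: "heisenberg_index \<Rightarrow> (heisenberg_index \<Rightarrow> 'a) \<times> (nat \<Rightarrow> 'a)"
  where "basis i = (\<lambda>j \<in> heisenberg_indices m. if j = i then \<one> else \<zero>, \<lambda>_ \<in> {1..k}. \<zero>)"

lemma indices [simp]:
  "\<Z> \<in> heisenberg_indices m"
  "\<X> i \<in> heisenberg_indices m \<longleftrightarrow> i \<in> {1..m}" "\<Y> i \<in> heisenberg_indices m \<longleftrightarrow> i \<in> {1..m}"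
  by (auto simp: heisenberg_indices_def)

lemma HA_lie_algebra: "lie_algebra K HA"
  by (intro lie_direct_sum_lie_algebra heisenberg_lie_algebra abelian_lie_algebra_lie_algebra
      field_axioms)

lemma HA_simps:
  "carrier HA = (heisenberg_indices m \<rightarrow>\<^sub>E carrier K) \<times> ({1..k} \<rightarrow>\<^sub>E carrier K)"
  "\<zero>\<^bsub>HA\<^esub> = (\<lambda>j \<in> heisenberg_indices m. \<zero>, \<lambda>_ \<in> {1..k}. \<zero>)"
  "u \<oplus>\<^bsub>HA\<^esub> v = (\<lambda>j \<in> heisenberg_indices m. fst u j \<oplus> fst v j, \<lambda>j \<in> {1..k}. snd u j \<oplus> snd v j)"
  "a \<odot>\<^bsub>HA\<^esub> u = (\<lambda>j \<in> heisenberg_indices m. a \<otimes> fst u j, \<lambda>j \<in> {1..k}. a \<otimes> snd u j)"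
  by (auto simp: lie_direct_sum_def direct_sum_def heisenberg_def abelian_lie_algebra_def
      func_space_def module.defs lie_algebra.defs split: prod.splits)

lemma HA_bracket: "\<lbrakk>u, v\<rbrakk>\<^bsub>HA\<^esub> = central (symp (fst u) (fst v))"
  by (auto simp: lie_direct_sum_def direct_sum_def heisenberg_def abelian_lie_algebra_def
      func_space_def module.defs lie_algebra.defs central_def symp_def)

lemma central_zero: "central \<zero> = \<zero>\<^bsub>HA\<^esub>"
  by (auto simp: central_def HA_simps)

lemma central_eq_zero_iff: "central c = \<zero>\<^bsub>HA\<^esub> \<longleftrightarrow> c = \<zero>"
proof
  assume "central c = \<zero>\<^bsub>HA\<^esub>"
  then have "fst (central c) \<Z> = fst \<zero>\<^bsub>HA\<^esub> \<Z>" by simp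
  then show "c = \<zero>" by (simp add: central_def HA_simps)
qed (simp add: central_zero)

lemma basis_closed: "basis i \<in> carrier HA"
  by (auto simp: basis_def HA_simps)

lemma HA_coord_closed:
  "w \<in> carrier HA \<Longrightarrow> j \<in> heisenberg_indices m \<Longrightarrow> fst w j \<in> carrier K"
  by (auto simp: HA_simps)

lemma bracket_basis_X:
  assumes w: "w \<in> carrier HA" and i: "i \<in> {1..m}"
  shows "\<lbrakk>basis (\<X> i), w\<rbrakk>\<^bsub>HA\<^esub> = central (fst w (\<Y> i))"
proof -
  have "symp (fst (basis (\<X> i))) (fst w) = (\<Oplus>j \<in> {1..m}. if i = j then fst w (\<Y> j) else \<zero>)"
    unfolding symp_def
    using w i by (intro finsum_cong') (auto simp: basis_def HA_coord_closed minus_eq)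
  also have "\<dots> = fst w (\<Y> i)"
    using w i by (intro finsum_singleton) (auto simp: HA_coord_closed)
  finally show ?thesis by (simp add: HA_bracket)
qed

lemma bracket_basis_Y:
  assumes w: "w \<in> carrier HA" and i: "i \<in> {1..m}"
  shows "\<lbrakk>basis (\<Y> i), w\<rbrakk>\<^bsub>HA\<^esub> = central (\<ominus> fst w (\<X> i))"
proof -
  have "symp (fst (basis (\<Y> i))) (fst w) = (\<Oplus>j \<in> {1..m}. if i = j then \<ominus> fst w (\<X> j) else \<zero>)"
    unfolding symp_def
    using w i by (intro finsum_cong') (auto simp: basis_def HA_coord_closed minus_eq)
  also have "\<dots> = \<ominus> fst w (\<X> i)"
    using w i by (intro finsum_singleton) (auto simp: HA_coord_closed)
  finally show ?thesis by (simp add: HA_bracket)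
qed

lemma not_capable:
  assumes "m \<ge> 2"
  shows "\<not> capable K HA"
proof
  assume cap: "capable K HA"
  have i: "1 \<in> {1..m}" "2 \<in> {1..m}" using assms by auto
  have br: "\<lbrakk>basis (\<X> i), basis (\<Y> i)\<rbrakk>\<^bsub>HA\<^esub> = central \<one>" if "i \<in> {1..m}" for i
    using bracket_basis_X[OF basis_closed that, of "\<Y> i"] that by (simp add: basis_def)
  have "\<lbrakk>basis (\<X> 1), basis (\<Y> 1)\<rbrakk>\<^bsub>HA\<^esub> = \<zero>\<^bsub>HA\<^esub>"
  proof (rule capable_bracket_eq_zero[OF HA_lie_algebra cap, where x' = "basis (\<X> 2)" and y' = "basis (\<Y> 2)"])
    fix w assume w: "w \<in> carrier HA"
    \<comment> \<open>The summand \<open>v\<close> is the component of \<open>w\<close> in the span of \<open>x\<^sub>1\<close> and \<open>y\<^sub>1\<close>.\<close>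
    define u where "u = (\<lambda>j \<in> heisenberg_indices m. if j \<in> {\<X> 1, \<Y> 1} then \<zero> else fst w j, snd w)"
    define v where "v = (\<lambda>j \<in> heisenberg_indices m. if j \<in> {\<X> 1, \<Y> 1} then fst w j else \<zero>,
      \<lambda>j \<in> {1..k}. \<zero>)"
    have uv: "u \<in> carrier HA" "v \<in> carrier HA"
      using w by (auto simp: u_def v_def HA_simps)
    have "w = u \<oplus>\<^bsub>HA\<^esub> v"
    proof (rule prod_eqI)
      show "fst w = fst (u \<oplus>\<^bsub>HA\<^esub> v)"
        using w by (auto simp: HA_simps u_def v_def fun_eq_iff PiE_iff extensional_def)
      show "snd w = snd (u \<oplus>\<^bsub>HA\<^esub> v)"
        using w by (auto simp: HA_simps u_def v_def fun_eq_iff PiE_iff extensional_def)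
    qed
    moreover have "\<lbrakk>basis (\<X> 1), u\<rbrakk>\<^bsub>HA\<^esub> = \<zero>\<^bsub>HA\<^esub>" "\<lbrakk>basis (\<Y> 1), u\<rbrakk>\<^bsub>HA\<^esub> = \<zero>\<^bsub>HA\<^esub>"
      using i by (simp_all only: bracket_basis_X bracket_basis_Y uv) (simp_all add: u_def central_zero)
    moreover have "\<lbrakk>basis (\<X> 2), v\<rbrakk>\<^bsub>HA\<^esub> = \<zero>\<^bsub>HA\<^esub>" "\<lbrakk>basis (\<Y> 2), v\<rbrakk>\<^bsub>HA\<^esub> = \<zero>\<^bsub>HA\<^esub>"
      using i by (simp_all only: bracket_basis_X bracket_basis_Y uv) (simp_all add: v_def central_zero)
    ultimately show "\<exists>u \<in> carrier HA. \<exists>v \<in> carrier HA. w = u \<oplus>\<^bsub>HA\<^esub> v \<and>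
        \<lbrakk>basis (\<X> 1), u\<rbrakk>\<^bsub>HA\<^esub> = \<zero>\<^bsub>HA\<^esub> \<and> \<lbrakk>basis (\<Y> 1), u\<rbrakk>\<^bsub>HA\<^esub> = \<zero>\<^bsub>HA\<^esub> \<and>
        \<lbrakk>basis (\<X> 2), v\<rbrakk>\<^bsub>HA\<^esub> = \<zero>\<^bsub>HA\<^esub> \<and> \<lbrakk>basis (\<Y> 2), v\<rbrakk>\<^bsub>HA\<^esub> = \<zero>\<^bsub>HA\<^esub>"
      using uv by blast
  qed (use i in \<open>simp_all add: basis_closed br\<close>)
  then show False
    using i by (simp add: br central_eq_zero_iff)
qed

lemma capable_if_m_eq_1:
  assumes m: "m = 1" and fd: "fin_dim_lie_algebra K HA"
  shows "capable K HA"
proof -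
  interpret HA: fin_dim_lie_algebra K HA by (fact fd)
  have i: "1 \<in> {1..m}" using m by simp
  have coord: "fst w (\<X> 1) \<in> carrier K" "fst w (\<Y> 1) \<in> carrier K" if "w \<in> carrier HA" for w
    using HA_coord_closed[OF that, of "\<X> 1"] HA_coord_closed[OF that, of "\<Y> 1"] i by simp_all
  have symp: "symp u v = u (\<X> 1) \<otimes> v (\<Y> 1) \<ominus> u (\<Y> 1) \<otimes> v (\<X> 1)"
    if "u (\<X> 1) \<in> carrier K" "u (\<Y> 1) \<in> carrier K" "v (\<X> 1) \<in> carrier K" "v (\<Y> 1) \<in> carrier K"
    for u v
    unfolding symp_def using that by (simp add: m)
  interpret codim_one_abelian_ideal K HA "\<lambda>w. fst w (\<X> 1)" "basis (\<X> 1)" "basis \<Z>"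
  proof (unfold_locales, goal_cases)
    case (5 x y)
    then have "symp (fst x) (fst y) = \<zero>"
      using coord[of x] coord[of y] by (subst symp) (simp_all add: minus_eq)
    then show ?case by (simp add: HA_bracket central_zero)
  next
    case 10
    have "fst (basis \<Z>) \<Z> \<noteq> fst \<zero>\<^bsub>HA\<^esub> \<Z>" by (simp add: basis_def HA_simps)
    then show ?case by metis
  qed (use i in \<open>auto simp: basis_closed HA_coord_closed HA_bracket central_def basis_def HA_simps\<close>)
  show ?thesis by (rule capable_codim_one)
qed

end

theorem theorem3p5:
  fixes K :: "('a, 'r) ring_scheme" and L :: "('a, 'b) lie_algebra" and m k :: nat
  assumes "m \<ge> 1" and "k \<ge> 1"
    and "fin_dim_lie_algebra K L"
    and "lie_isomorphic K L (lie_direct_sum (heisenberg K m) (abelian_lie_algebra K k))"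
  shows "capable K L \<longleftrightarrow> m = 1"
proof -
  interpret L: fin_dim_lie_algebra K L by (fact assms(3))
  interpret heisenberg_abelian_sum K m k by unfold_locales
  have "fin_dim_lie_algebra K HA"
    using assms(3) HA_lie_algebra assms(4) by (rule fin_dim_lie_algebra_cong)
  then have "capable K HA \<longleftrightarrow> m = 1"
    using capable_if_m_eq_1 not_capable assms(1) by (metis One_nat_def Suc_1 le_neq_implies_less Suc_leI)
  then show ?thesis
    using capable_cong[OF L.lie_algebra_axioms assms(4)] by simp
qed

end
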